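(* Let $X$ be a set, $Y$ a finite set, and $\mathcal{H}$ a non-empty set of functions $X\to 2^Y$ such that for every $h\in\mathcal{H}$ there is $x\in X$ with $h(x)\neq\emptyset$. Then for all $N\in\mathbb{N}$, $\mathcal{M}^*_{\mathcal{H}}(N)=\mathrm{AL}(\mathcal{H},N)$, where $\mathcal{M}^*_{\mathcal{H}}(N)$ is the minimax (deterministic) mistake bound and $\mathrm{AL}(\mathcal{H},N)$ is the maximal rank of an ambiguous shattered $\mathcal{H}$-tree of depth at most $N$.
   Context: Conventions: $0\in\mathbb{N}$; $\Sigma^*$ is the set of finite words over $\Sigma$; for a word $w$, $w_k$ is its $k$-th symbol (starting from $0$) and $w_{:k}$ its prefix of length $k$. For $xy\in(X\times Y)^n$, $x\in X^n$ and $y\in Y^n$ denote its projections. Mistakes. A (deterministic) learner is a map $A:(X\times Y)^*\times X\to 2^Y$. For $h:X\to 2^Y$ and $xy\in(X\times Y)^n$, put $\mathcal{M}^A_h(xy):=\{k<n\mid y_k\notin A(xy_{:k},x_k)\text{ or }A(xy_{:k},x_k)\not\subseteq h(x_k)\}$. Let $\mathcal{C}_h(n)$ be the set of $xy\in(X\times Y)^n$ with $y_k\in h(x_k)$ for all $k<n$. Define $\mathcal{M}^A_h(N):=\max_{xy\in\mathcal{C}_h(N)}|\mathcal{M}^A_h(xy)|$, $\mathcal{M}^A_{\mathcal{H}}(N):=\max_{h\in\mathcal{H}}\mathcal{M}^A_h(N)$, $\mathcal{M}^*_{\mathcal{H}}(N):=\min_A\mathcal{M}^A_{\mathcal{H}}(N)$,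 the minimum being over all learners. Trees. A rooted tree is $(V,v_0,P)$ with $V$ a finite set, $v_0\in V$ (root), and $P:V\setminus\{v_0\}\to V$ (parent) such that for each $v\in V$ there is $k\in\mathbb{N}$ with $P^k(v)=v_0$. Write $E:=V\setminus\{v_0\}$ (vertices in $E$ are also viewed as edges to their parents), $V_f:=V\setminus P(E)$ (leaves), $V_p:=V\setminus V_f$, and $P^*(v):=\{v,P(v),P^2(v),\dots\}$ (ancestors of $v$ including itself). The depth of the tree is $\max_{u\in V_f}|P^*(u)|-1$. An ambiguous shattered $\mathcal{H}$-tree is $T=(V,v_0,P,\mathbf{x},\mathbf{y},\mathbf{h},E_0)$ with $(V,v_0,P)$ a rooted tree, $\mathbf{x}:V_p\to X$, $\mathbf{y}:E\to Y$, $\mathbf{h}:V_f\to\mathcal{H}$ (written with subscripts) and $E_0\subseteq E$ such that: (i) for every $v\in V_p$, $|P^{-1}(v)\cap E_0|=1$; (ii) if $a\neq b$ in $E$ and $P(a)=P(b)$ then $\mathbf{y}_a\neq\mathbf{y}_b$; (iii) for every $u\in V_f$ and $a\in P^*(u)\setminus\{v_0\}$, $\mathbf{y}_a\in\mathbf{h}_u(\mathbf{x}_{P(a)})$. For $u\in V_f$, $R_T(u)$ is the set of $a\in P^*(u)\setminus\{v_0\}$ such that either $a\notin E_0$ or there is $b\in P^{-1}(P(a))$ with $\mathbf{y}_b\notin\mathbf{h}_u(\mathbf{x}_{P(a)})$. The rank of $T$ is $\min_{u\in V_f}|R_T(u)|$. *)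

theory Defs
  imports Main
begin

text \<open>
  The sets \<open>X\<close> and \<open>Y\<close> are the types \<open>'x\<close> and \<open>'y\<close>, an element of \<open>(X \<times> Y)\<^sup>n\<close> is a list of pairs
  of length \<open>n\<close>, and \<open>take k w\<close> is the prefix of length \<open>k\<close> of \<open>w\<close>.
\<close>

type_synonym ('x, 'y) learner = "('x \<times> 'y) list \<Rightarrow> 'x \<Rightarrow> 'y set"

definition mistakes :: "('x, 'y) learner \<Rightarrow> ('x \<Rightarrow> 'y set) \<Rightarrow> ('x \<times> 'y) list \<Rightarrow> nat set" where
  "mistakes A h xy =
     {k. k < length xy \<and>
         (snd (xy ! k) \<notin> A (take k xy) (fst (xy ! k)) \<or>
          \<not> A (take k xy) (fst (xy ! k)) \<subseteq> h (fst (xy ! k)))}"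

definition consistent_words :: "('x \<Rightarrow> 'y set) \<Rightarrow> nat \<Rightarrow> ('x \<times> 'y) list set" where
  "consistent_words h n = {xy. length xy = n \<and> (\<forall>k<n. snd (xy ! k) \<in> h (fst (xy ! k)))}"

text \<open>
  The maxima and minima below range over sets of natural numbers bounded by \<open>N\<close>, hence finite even
  where the index set is infinite. These sets are non-empty as soon as \<open>H\<close> is non-empty and no
  \<open>h \<in> H\<close> is empty-valued everywhere; otherwise \<open>Max\<close> is unspecified.
\<close>

definition mistake_bound_hyp ::
    "('x, 'y) learner \<Rightarrow> ('x \<Rightarrow> 'y set) \<Rightarrow> nat \<Rightarrow> nat" where
  "mistake_bound_hyp A h N = Max ((\<lambda>xy. card (mistakes A h xy)) ` consistent_words h N)"

definition mistake_bound ::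
    "('x, 'y) learner \<Rightarrow> ('x \<Rightarrow> 'y set) set \<Rightarrow> nat \<Rightarrow> nat" where
  "mistake_bound A H N = Max ((\<lambda>h. mistake_bound_hyp A h N) ` H)"

definition minimax_mistake_bound :: "('x \<Rightarrow> 'y set) set \<Rightarrow> nat \<Rightarrow> nat" where
  "minimax_mistake_bound H N = Min (range (\<lambda>A. mistake_bound A H N))"


text \<open>
  The maps of a tree are total functions, of which only the restrictions to the intended domains
  are used: \<open>parent\<close> and \<open>ylab\<close> on non-root vertices, \<open>xlab\<close> on non-leaves, \<open>hlab\<close> on leaves.
\<close>

record 'v rooted_tree =
  verts :: "'v set"
  root :: 'v
  parent :: "'v \<Rightarrow> 'v"

definition edges :: "('v, 'z) rooted_tree_scheme \<Rightarrow> 'v set" where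
  "edges T = verts T - {root T}"

definition leaves :: "('v, 'z) rooted_tree_scheme \<Rightarrow> 'v set" where
  "leaves T = verts T - parent T ` edges T"

definition inner_verts :: "('v, 'z) rooted_tree_scheme \<Rightarrow> 'v set" where
  "inner_verts T = verts T - leaves T"

definition children :: "('v, 'z) rooted_tree_scheme \<Rightarrow> 'v \<Rightarrow> 'v set" where
  "children T v = {a \<in> edges T. parent T a = v}"

text \<open>
  Since \<open>parent T\<close> also has a (meaningless) value at the root, the iteration stops at the root.
\<close>

definition ancestors :: "('v, 'z) rooted_tree_scheme \<Rightarrow> 'v \<Rightarrow> 'v set" where
  "ancestors T v = {(parent T ^^ k) v | k. \<forall>j<k. (parent T ^^ j) v \<noteq> root T}"

definition is_rooted_tree :: "('v, 'z) rooted_tree_scheme \<Rightarrow> bool" where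
  "is_rooted_tree T \<longleftrightarrow>
     finite (verts T) \<and> root T \<in> verts T \<and> parent T ` edges T \<subseteq> verts T \<and>
     (\<forall>v\<in>verts T. \<exists>k. (parent T ^^ k) v = root T)"

definition depth :: "('v, 'z) rooted_tree_scheme \<Rightarrow> nat" where
  "depth T = Max ((\<lambda>u. card (ancestors T u)) ` leaves T) - 1"

record ('v, 'x, 'y) labelled_tree = "'v rooted_tree" +
  xlab :: "'v \<Rightarrow> 'x"
  ylab :: "'v \<Rightarrow> 'y"
  hlab :: "'v \<Rightarrow> 'x \<Rightarrow> 'y set"
  edges0 :: "'v set"

definition ambiguous_shattered_tree ::
    "('x \<Rightarrow> 'y set) set \<Rightarrow> ('v, 'x, 'y) labelled_tree \<Rightarrow> bool" where
  "ambiguous_shattered_tree H T \<longleftrightarrow>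
     is_rooted_tree T \<and> hlab T ` leaves T \<subseteq> H \<and> edges0 T \<subseteq> edges T \<and>
     (\<forall>v\<in>inner_verts T. card (children T v \<inter> edges0 T) = 1) \<and>
     (\<forall>a\<in>edges T. \<forall>b\<in>edges T. a \<noteq> b \<and> parent T a = parent T b \<longrightarrow> ylab T a \<noteq> ylab T b) \<and>
     (\<forall>u\<in>leaves T. \<forall>a\<in>ancestors T u - {root T}. ylab T a \<in> hlab T u (xlab T (parent T a)))"

definition rank_edges :: "('v, 'x, 'y) labelled_tree \<Rightarrow> 'v \<Rightarrow> 'v set" where
  "rank_edges T u =
     {a \<in> ancestors T u - {root T}.
        a \<notin> edges0 T \<or>
        (\<exists>b\<in>children T (parent T a). ylab T b \<notin> hlab T u (xlab T (parent T a)))}"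

definition rank :: "('v, 'x, 'y) labelled_tree \<Rightarrow> nat" where
  "rank T = Min ((\<lambda>u. card (rank_edges T u)) ` leaves T)"

text \<open>
  Depth and rank are invariant under renaming vertices and vertex sets are finite, so taking the
  vertices to be natural numbers is no loss of generality. The set of ranks is bounded by \<open>N\<close>, and
  for non-empty \<open>H\<close> it contains the rank \<open>0\<close> of a one-vertex tree.
\<close>

definition AL :: "('x \<Rightarrow> 'y set) set \<Rightarrow> nat \<Rightarrow> nat" where
  "AL H N = Max {rank T | T :: (nat, 'x, 'y) labelled_tree.
                   ambiguous_shattered_tree H T \<and> depth T \<le> N}"

end

theory Submission
  imports Defs "HOL-Library.Countable_Set"
begin

text \<open>
  Both quantities equal the largest \<open>m\<close> for which the adversary wins the finite game where in each
  round he presents \<open>x\<close>, sees the predicted set \<open>S\<close> and reveals \<open>y\<close>, and finally exhibits a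
  consistent \<open>h \<in> H\<close> with at least \<open>m\<close> mistakes. A tree yields a strategy: against a
  prediction containing all labels of the children move to the child in \<open>E\<^sub>0\<close>, otherwise move to a
  child whose label was not predicted. Conversely, in a winning position with query \<open>x\<close> let \<open>D\<close> be
  the set of labels which win when the round counts as a mistake for every hypothesis. A winning
  reply \<open>y\<close> to the prediction \<open>D\<close> must itself lie in \<open>D\<close>, since outside of \<open>D\<close> it would be a
  mistake for every hypothesis. So \<open>D\<close> labels the children of a tree vertex and \<open>y\<close> its edge in
  \<open>E\<^sub>0\<close>.
\<close>

section \<open>The game\<close>

fun mistaken :: "('x \<Rightarrow> 'y set) \<Rightarrow> 'x \<times> 'y set \<times> 'y \<Rightarrow> bool" where
  "mistaken h (x, S, y) \<longleftrightarrow> y \<notin> S \<or> \<not> S \<subseteq> h x"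

definition score :: "('x \<Rightarrow> 'y set) \<Rightarrow> ('x \<times> 'y set \<times> 'y) list \<Rightarrow> nat" where
  "score h rs = length (filter (mistaken h) rs)"

definition consistent :: "('x \<Rightarrow> 'y set) \<Rightarrow> ('x \<times> 'y set \<times> 'y) list \<Rightarrow> bool" where
  "consistent h rs \<longleftrightarrow> (\<forall>(x, S, y)\<in>set rs. y \<in> h x)"

lemma score_simps [simp]:
  "score h [] = 0"
  "score h (r # rs) = of_bool (mistaken h r) + score h rs"
  by (simp_all add: score_def)

lemma consistent_simps [simp]:
  "consistent h []"
  "consistent h ((x, S, y) # rs) \<longleftrightarrow> y \<in> h x \<and> consistent h rs"
  by (auto simp: consistent_def)

lemma score_le_length: "score h rs \<le> length rs"
  by (simp add: score_def)

text \<open>Rounds are listed with the most recent one first; \<open>n\<close> is the number of rounds to go.\<close>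

fun forces :: "('x \<Rightarrow> 'y set) set \<Rightarrow> nat \<Rightarrow> nat \<Rightarrow> ('x \<times> 'y set \<times> 'y) list \<Rightarrow> bool" where
  "forces H m 0 rs \<longleftrightarrow> (\<exists>h\<in>H. consistent h rs \<and> m \<le> score h rs)"
| "forces H m (Suc n) rs \<longleftrightarrow> (\<exists>x. \<forall>S. \<exists>y. forces H m n ((x, S, y) # rs))"

text \<open>The end of the game reads the history only through the consistency and score of each
  hypothesis, and a further round changes both independently of the earlier ones.\<close>

lemma forces_cong:
  assumes "\<And>h. consistent h rs = consistent h rs'" "\<And>h. score h rs = score h rs'"
  shows "forces H m n rs = forces H m n rs'"
  using assms
proof (induction n arbitrary: rs rs')
  case (Suc n)
  have "forces H m n ((x, S, y) # rs) = forces H m n ((x, S, y) # rs')" for x S y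
    by (rule Suc.IH) (simp_all add: Suc.prems)
  then show ?case by simp
qed simp

lemma forces_unpredicted:
  assumes "y \<notin> S" "y \<notin> S'"
  shows "forces H m n ((x, S, y) # rs) = forces H m n ((x, S', y) # rs)"
  by (rule forces_cong) (simp_all add: assms)

text \<open>Each round adds at most one mistake. This later bounds the ranks of trees, so that their
  maximum is meaningful.\<close>

lemma forces_le: "forces H m n rs \<Longrightarrow> m \<le> n + length rs"
proof (induction n arbitrary: rs)
  case 0
  then show ?case by (auto intro: order_trans [OF _ score_le_length])
next
  case (Suc n)
  then obtain x where "\<forall>S. \<exists>y. forces H m n ((x, S, y) # rs)" by auto
  then obtain y where "forces H m n ((x, {}, y) # rs)" by blast
  from Suc.IH [OF this] show ?case by simp
qed

lemma forces_mono: "forces H m n rs \<Longrightarrow> k \<le> m \<Longrightarrow> forces H k n rs"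
proof (induction n arbitrary: rs)
  case 0
  then show ?case using order_trans by auto
next
  case (Suc n)
  then show ?case by (metis forces.simps(2))
qed

text \<open>The adversary can idle: asking \<open>x\<close> and revealing a label in
  \<open>h x\<close> keeps \<open>h\<close> consistent and never lowers its score. This serves
  leaves reached before the last round.\<close>

lemma forces_padding:
  assumes "h \<in> H" "h x \<noteq> {}" "consistent h rs" "m \<le> score h rs"
  shows "forces H m n rs"
  using assms(3,4)
proof (induction n arbitrary: rs)
  case 0
  then show ?case using assms(1) by auto
next
  case (Suc n)
  obtain y where "y \<in> h x" using assms(2) by auto
  then have "forces H m n ((x, S, y) # rs)" for S
    by (intro Suc.IH) (simp_all add: Suc.prems trans_le_add2)
  then show ?case by auto
qed

text \<open>Normal form of a winning move: of the replies to all predictions only those to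
  \<open>D\<close> and to the empty set are kept, the former for the edge in
  \<open>E\<^sub>0\<close>, the latter for its siblings.\<close>

lemma forces_SucE:
  assumes "forces H m (Suc n) rs"
  obtains x D y where "y \<in> D" "forces H m n ((x, D, y) # rs)"
    "\<And>z. z \<in> D \<Longrightarrow> forces H m n ((x, {}, z) # rs)"
proof -
  from assms obtain x where x: "\<And>S. \<exists>y. forces H m n ((x, S, y) # rs)" by auto
  define D where "D = {z. forces H m n ((x, {}, z) # rs)}"
  from x obtain y where y: "forces H m n ((x, D, y) # rs)" by blast
  have "y \<in> D"
  proof (rule ccontr)
    assume "y \<notin> D"
    with y have "forces H m n ((x, {}, y) # rs)"
      by (simp add: forces_unpredicted [of y D "{}"])
    with \<open>y \<notin> D\<close> show False by (simp add: D_def)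
  qed
  with y show thesis by (intro that) (auto simp: D_def)
qed

section \<open>Learners\<close>

text \<open>The reversal puts the latest round first, as in \<open>forces\<close>, so that appending
  a pair to the word adds a round at the head.\<close>

definition transcript ::
    "('x, 'y) learner \<Rightarrow> ('x \<times> 'y) list \<Rightarrow> ('x \<times> 'y set \<times> 'y) list" where
  "transcript A w =
     rev (map (\<lambda>k. (fst (w ! k), A (take k w) (fst (w ! k)), snd (w ! k))) [0..<length w])"

lemma transcript_Nil [simp]: "transcript A [] = []"
  by (simp add: transcript_def)

lemma transcript_snoc [simp]: "transcript A (w @ [(x, y)]) = (x, A w x, y) # transcript A w"
  by (simp add: transcript_def nth_append)

lemma length_transcript [simp]: "length (transcript A w) = length w"
  by (simp add: transcript_def)

lemma score_transcript: "score h (transcript A w) = card (mistakes A h w)"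
proof -
  have "score h (transcript A w) =
      length (filter (mistaken h) (map (\<lambda>k. (fst (w ! k), A (take k w) (fst (w ! k)), snd (w ! k)))
        [0..<length w]))"
    by (simp add: score_def transcript_def flip: rev_filter)
  also have "\<dots> = card (mistakes A h w)"
    unfolding length_filter_conv_card mistakes_def by (intro arg_cong [where f = card]) auto
  finally show ?thesis .
qed

lemma consistent_transcript:
  "consistent h (transcript A w) \<longleftrightarrow> w \<in> consistent_words h (length w)"
  by (auto simp: consistent_def transcript_def consistent_words_def)

text \<open>Let the adversary's strategy answer the prediction \<open>A w x\<close> in each round;
  the word \<open>w\<close> of past rounds is general for the induction.\<close>

lemma forces_imp_mistakes:
  assumes "forces H m n (transcript A w)"
  shows "\<exists>h\<in>H. \<exists>xy\<in>consistent_words h (length w + n). m \<le> card (mistakes A h xy)"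
  using assms
proof (induction n arbitrary: w)
  case 0
  then show ?case by (auto simp: score_transcript consistent_transcript)
next
  case (Suc n)
  then obtain x where "\<forall>S. \<exists>y. forces H m n ((x, S, y) # transcript A w)" by auto
  then obtain y where "forces H m n ((x, A w x, y) # transcript A w)" by blast
  then have "forces H m n (transcript A (w @ [(x, y)]))" by simp
  from Suc.IH [OF this] show ?case by simp
qed

text \<open>Determinacy of the finite game: where the adversary cannot win, every query has a
  prediction after which he still cannot win, and the learner always makes such a
  prediction.\<close>

lemma not_forces_imp_learner:
  assumes "\<not> forces H m N []"
  shows "\<exists>A. \<forall>h\<in>H. \<forall>xy\<in>consistent_words h N. card (mistakes A h xy) < m"
proof -
  define reply where
    "reply rs x = (SOME S. \<forall>y. \<not> forces H m (N - Suc (length rs)) ((x, S, y) # rs))" for rs x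
  \<comment> \<open>A learner is given only the pairs, so it recovers its own earlier predictions by
    replaying the word.\<close>
  define play where "play = foldl (\<lambda>rs (x, y). (x, reply rs x, y) # rs) []"
  define A where "A w = reply (play w)" for w
  have play: "play w = transcript A w" for w
    by (induction w rule: rev_induct) (auto simp: play_def A_def)
  have "length w \<le> N \<Longrightarrow> \<not> forces H m (N - length w) (transcript A w)" for w
  proof (induction w rule: rev_induct)
    case Nil
    then show ?case using assms by simp
  next
    case (snoc r w)
    obtain x y where r: "r = (x, y)" by fastforce
    from snoc.prems have "N - length w = Suc (N - Suc (length w))" by simp
    with snoc have "\<not> forces H m (Suc (N - Suc (length w))) (transcript A w)" by simp
    then have "\<exists>S. \<forall>y. \<not> forces H m (N - Suc (length w)) ((x, S, y) # transcript A w)" by auto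
    from someI_ex [OF this]
    have "\<not> forces H m (N - Suc (length w)) ((x, A w x, y) # transcript A w)"
      by (simp add: A_def play reply_def)
    then show ?case by (simp add: r)
  qed
  then have lost: "length w = N \<Longrightarrow> \<not> forces H m 0 (transcript A w)" for w
    by (metis diff_self_eq_0 order_refl)
  have "card (mistakes A h xy) < m" if "h \<in> H" "xy \<in> consistent_words h N" for h xy
  proof -
    have "length xy = N" using that(2) by (simp add: consistent_words_def)
    with lost [of xy] that show ?thesis by (auto simp: consistent_transcript score_transcript)
  qed
  then show ?thesis by blast
qed

lemma forces_iff_mistakes:
  "forces H m N [] \<longleftrightarrow>
     (\<forall>A. \<exists>h\<in>H. \<exists>xy\<in>consistent_words h N. m \<le> card (mistakes A h xy))"
proof
  assume "forces H m N []"
  then show "\<forall>A. \<exists>h\<in>H. \<exists>xy\<in>consistent_words h N. m \<le> card (mistakes A h xy)"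
    using forces_imp_mistakes [of H m N _ "[]"] by simp
next
  assume *: "\<forall>A. \<exists>h\<in>H. \<exists>xy\<in>consistent_words h N. m \<le> card (mistakes A h xy)"
  show "forces H m N []"
  proof (rule ccontr)
    assume "\<not> forces H m N []"
    from not_forces_imp_learner [OF this] * show False by (meson not_le)
  qed
qed

lemma card_mistakes_le: "xy \<in> consistent_words h N \<Longrightarrow> card (mistakes A h xy) \<le> N"
  using score_le_length [of h "transcript A xy"]
  by (simp add: score_transcript consistent_words_def)

text \<open>Lower bounds turn \<open>Min\<close> into a universal and \<open>Max\<close> into an
  existential quantifier, provided the sets are finite and non-empty; the non-empty values of
  \<open>h\<close> supply consistent words.\<close>

lemma le_minimax_mistake_bound_iff:
  fixes H :: "('x \<Rightarrow> 'y set) set"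
  assumes "H \<noteq> {}" and nonempty: "\<And>h. h \<in> H \<Longrightarrow> \<exists>x. h x \<noteq> {}"
  shows "m \<le> minimax_mistake_bound H N \<longleftrightarrow> forces H m N []"
proof -
  have fin: "finite ((\<lambda>xy. card (mistakes A h xy)) ` consistent_words h N)" for A h
    by (rule finite_subset [of _ "{..N}"]) (auto simp: card_mistakes_le)
  have ne: "consistent_words h N \<noteq> {}" if h: "h \<in> H" for h
  proof -
    obtain x y where "y \<in> h x" using nonempty [OF h] by auto
    then have "replicate N (x, y) \<in> consistent_words h N" by (simp add: consistent_words_def)
    then show ?thesis by blast
  qed
  have hyp: "mistake_bound_hyp A h N \<le> N" if "h \<in> H" for A h
    using Max_in [OF fin, of A h] ne [OF that] by (auto simp: mistake_bound_hyp_def card_mistakes_le)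
  have fin': "finite ((\<lambda>h. mistake_bound_hyp A h N) ` H)" for A
    by (rule finite_subset [of _ "{..N}"]) (auto simp: hyp)
  have bound: "mistake_bound A H N \<le> N" for A
    using Max_in [OF fin', of A] hyp \<open>H \<noteq> {}\<close> by (auto simp: mistake_bound_def)
  have fin'': "finite (range (\<lambda>A. mistake_bound A H N))"
    by (rule finite_subset [of _ "{..N}"]) (auto simp: bound)
  have "m \<le> mistake_bound_hyp A h N \<longleftrightarrow>
      (\<exists>xy\<in>consistent_words h N. m \<le> card (mistakes A h xy))" if "h \<in> H" for A h
    unfolding mistake_bound_hyp_def using Max_ge_iff [OF fin, of A h m] ne [OF that] by auto
  moreover have "m \<le> mistake_bound A H N \<longleftrightarrow> (\<exists>h\<in>H. m \<le> mistake_bound_hyp A h N)" for A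
    unfolding mistake_bound_def using Max_ge_iff [OF fin'] \<open>H \<noteq> {}\<close> by auto
  moreover have "m \<le> minimax_mistake_bound H N \<longleftrightarrow> (\<forall>A. m \<le> mistake_bound A H N)"
    unfolding minimax_mistake_bound_def using Min_ge_iff [OF fin''] by auto
  ultimately show ?thesis by (simp add: forces_iff_mistakes)
qed

section \<open>Rooted trees\<close>

lemma ancestors_root [simp]: "ancestors T (root T) = {root T}"
proof -
  have "(parent T ^^ k) (root T) = root T"
    if "\<forall>j<k. (parent T ^^ j) (root T) \<noteq> root T" for k
    using that by (cases k) force+
  then show ?thesis
    unfolding ancestors_def by (fastforce intro: exI [of _ 0])
qed

lemma ancestors_parent:
  assumes "v \<noteq> root T"
  shows "ancestors T v = insert v (ancestors T (parent T v))"
proof -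
  have stop: "(\<forall>j<Suc k. (parent T ^^ j) v \<noteq> root T) \<longleftrightarrow>
      (\<forall>j<k. (parent T ^^ j) (parent T v) \<noteq> root T)" for k
    using assms unfolding All_less_Suc2 by (simp add: funpow_swap1)
  have split: "(\<exists>k. Q k) \<longleftrightarrow> Q 0 \<or> (\<exists>k. Q (Suc k))" for Q :: "nat \<Rightarrow> bool"
    by (metis not0_implies_Suc)
  have "a \<in> ancestors T v \<longleftrightarrow> a = v \<or> a \<in> ancestors T (parent T v)" for a
    unfolding ancestors_def mem_Collect_eq
    by (subst split, subst stop) (simp add: funpow_swap1)
  then show ?thesis by auto
qed

lemma self_in_ancestors [simp]: "v \<in> ancestors T v"
  by (cases "v = root T") (simp_all add: ancestors_parent)

locale rooted =
  fixes T :: "('v, 'z) rooted_tree_scheme"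
  assumes is_rooted_tree: "is_rooted_tree T"
begin

lemma finite_verts [simp]: "finite (verts T)"
  and root_in_verts [simp]: "root T \<in> verts T"
  and parent_in_verts: "a \<in> edges T \<Longrightarrow> parent T a \<in> verts T"
  and reaches_root: "v \<in> verts T \<Longrightarrow> \<exists>k. (parent T ^^ k) v = root T"
  using is_rooted_tree by (auto simp: is_rooted_tree_def)

text \<open>Distance to the root. \<open>LEAST\<close> takes the first arrival there, since iterates
  of \<open>parent T\<close> past the root are arbitrary.\<close>

definition level :: "'v \<Rightarrow> nat" where
  "level v = (LEAST k. (parent T ^^ k) v = root T)"

lemma level_edge: "a \<in> edges T \<Longrightarrow> level a = Suc (level (parent T a))"
proof -
  assume a: "a \<in> edges T"
  then obtain k where "(parent T ^^ k) a = root T"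
    using reaches_root by (auto simp: edges_def)
  then show ?thesis
    unfolding level_def using a by (subst Least_Suc) (auto simp: edges_def funpow_swap1)
qed

lemma vert_induct [consumes 1, case_names root edge]:
  assumes "v \<in> verts T" "P (root T)" "\<And>a. a \<in> edges T \<Longrightarrow> P (parent T a) \<Longrightarrow> P a"
  shows "P v"
  using assms(1)
proof (induction "level v" arbitrary: v rule: less_induct)
  case less
  show ?case
  proof (cases "v = root T")
    case False
    with less.prems have "v \<in> edges T" by (simp add: edges_def)
    then show ?thesis using less.hyps assms(3) level_edge parent_in_verts by simp
  qed (simp add: assms(2))
qed

lemma ancestors_edge: "a \<in> edges T \<Longrightarrow> ancestors T a = insert a (ancestors T (parent T a))"
  by (simp add: ancestors_parent edges_def)

lemma ancestors_subset: "v \<in> verts T \<Longrightarrow> ancestors T v \<subseteq> verts T"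
  by (induction rule: vert_induct) (auto simp: ancestors_edge edges_def)

lemma finite_ancestors: "v \<in> verts T \<Longrightarrow> finite (ancestors T v)"
  using ancestors_subset finite_subset by fastforce

lemma level_ancestor: "v \<in> verts T \<Longrightarrow> b \<in> ancestors T v \<Longrightarrow> level b \<le> level v"
  by (induction rule: vert_induct) (auto simp: ancestors_edge level_edge)

lemma notin_ancestors_parent: "a \<in> edges T \<Longrightarrow> a \<notin> ancestors T (parent T a)"
  using level_ancestor level_edge parent_in_verts by fastforce

lemma card_ancestors_edge:
  "a \<in> edges T \<Longrightarrow> card (ancestors T a) = Suc (card (ancestors T (parent T a)))"
  by (simp add: ancestors_edge finite_ancestors notin_ancestors_parent parent_in_verts)

lemma ancestors_trans:
  "w \<in> verts T \<Longrightarrow> v \<in> ancestors T w \<Longrightarrow> ancestors T v \<subseteq> ancestors T w"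
  by (induction rule: vert_induct) (auto simp: ancestors_edge)

text \<open>A vertex of maximal level among those below \<open>v\<close> is a leaf, since a child
  would be deeper still.\<close>

lemma leaf_below:
  assumes "v \<in> verts T"
  shows "\<exists>u\<in>leaves T. v \<in> ancestors T u"
proof -
  let ?B = "{u \<in> verts T. v \<in> ancestors T u}"
  have "finite ?B" "?B \<noteq> {}" using assms by auto
  then have "Max (level ` ?B) \<in> level ` ?B" by (intro Max_in) auto
  then obtain u where u: "u \<in> ?B" "level u = Max (level ` ?B)" by auto
  have max: "level w \<le> level u" if "w \<in> ?B" for w
    unfolding u(2) using \<open>finite ?B\<close> that by (intro Max_ge) auto
  have "u \<notin> parent T ` edges T"
  proof
    assume "u \<in> parent T ` edges T"
    then obtain a where "a \<in> edges T" "u = parent T a" by blast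
    with u(1) have "a \<in> ?B" "level u < level a"
      by (auto simp: ancestors_edge edges_def level_edge)
    with max show False by force
  qed
  with u(1) show ?thesis by (auto simp: leaves_def)
qed

lemma leaves_nonempty [simp]: "leaves T \<noteq> {}"
  using leaf_below root_in_verts by blast

lemma finite_leaves [simp]: "finite (leaves T)"
  by (simp add: leaves_def)

lemma depth_le_iff: "depth T \<le> n \<longleftrightarrow> (\<forall>u\<in>leaves T. card (ancestors T u) \<le> Suc n)"
  by (auto simp: depth_def le_diff_conv)

end

lemma le_rank_iff:
  assumes "is_rooted_tree T"
  shows "m \<le> rank T \<longleftrightarrow> (\<forall>u\<in>leaves T. m \<le> card (rank_edges T u))"
proof -
  interpret rooted T by unfold_locales (rule assms)
  show ?thesis by (simp add: rank_def)
qed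

section \<open>From trees to strategies\<close>

lemma tree_imp_forces:
  fixes H :: "('x \<Rightarrow> 'y set) set" and T :: "('v, 'x, 'y) labelled_tree"
  assumes T: "ambiguous_shattered_tree H T" and depth: "depth T \<le> N"
    and nonempty: "\<And>h. h \<in> H \<Longrightarrow> \<exists>x. h x \<noteq> {}"
  shows "forces H (rank T) N []"
proof -
  interpret rooted T by unfold_locales (use T in \<open>simp add: ambiguous_shattered_tree_def\<close>)
  have rank: "rank T \<le> card (rank_edges T u)" if "u \<in> leaves T" for u
    using le_rank_iff [OF is_rooted_tree] that by blast
  have hlab: "hlab T u \<in> H" if "u \<in> leaves T" for u
    using T that by (auto simp: ambiguous_shattered_tree_def)
  \<comment> \<open>Invariant with the adversary at \<open>v\<close>: the rounds used are as many as
    the edges above \<open>v\<close>, and each leaf below \<open>v\<close> fits all answers and has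
    a mistake for each of its rank edges above \<open>v\<close>.\<close>
  have *: "forces H (rank T) n rs"
    if "v \<in> verts T" "n + card (ancestors T v) = Suc N"
      "\<And>u. \<lbrakk>u \<in> leaves T; v \<in> ancestors T u\<rbrakk> \<Longrightarrow> consistent (hlab T u) rs \<and>
          card (rank_edges T u \<inter> ancestors T v) \<le> score (hlab T u) rs"
    for v n rs
    using that
  proof (induction n arbitrary: v rs)
    case (0 v rs)
    obtain u where u: "u \<in> leaves T" "v \<in> ancestors T u"
      using leaf_below "0.prems"(1) by blast
    have uV: "u \<in> verts T" using u by (simp add: leaves_def)
    \<comment> \<open>With no rounds left \<open>v\<close> has \<open>Suc N\<close> ancestors, so
      the depth bound leaves no room between \<open>v\<close> and the leaf \<open>u\<close>.\<close>
    have "card (ancestors T u) \<le> card (ancestors T v)"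
      using depth u(1) "0.prems"(2) by (simp add: depth_le_iff)
    then have "ancestors T v = ancestors T u"
      using ancestors_trans [OF uV u(2)] finite_ancestors [OF uV] by (simp add: card_seteq)
    then have "rank_edges T u \<inter> ancestors T v = rank_edges T u"
      by (auto simp: rank_edges_def)
    with "0.prems"(3) [OF u] rank [OF u(1)] show ?case
      using hlab [OF u(1)] by auto
  next
    case (Suc n v rs)
    show ?case
    proof (cases "v \<in> leaves T")
      case True
      have "rank_edges T v \<inter> ancestors T v = rank_edges T v"
        by (auto simp: rank_edges_def)
      then have "consistent (hlab T v) rs" "rank T \<le> score (hlab T v) rs"
        using Suc.prems(3) [OF True] rank [OF True] by auto
      then show ?thesis using forces_padding nonempty hlab [OF True] by metis
    next
      case False
      with Suc.prems(1) have v: "v \<in> inner_verts T" by (simp add: inner_verts_def)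
      have "\<exists>y. forces H (rank T) n ((xlab T v, S, y) # rs)" for S
      proof -
        obtain e where "children T v \<inter> edges0 T = {e}"
          using T v by (auto simp: ambiguous_shattered_tree_def card_1_singleton_iff)
        \<comment> \<open>A child with an unpredicted label if there is one, otherwise the child
          \<open>e\<close> in \<open>E\<^sub>0\<close>.\<close>
        then obtain a where a: "a \<in> children T v"
          and sure: "ylab T a \<notin> S \<or> (a \<in> edges0 T \<and> ylab T ` children T v \<subseteq> S)"
          by blast
        have aE: "a \<in> edges T" and pa: "parent T a = v" using a by (auto simp: children_def)
        have "forces H (rank T) n ((xlab T v, S, ylab T a) # rs)"
        proof (rule Suc.IH)
          show "a \<in> verts T" using aE by (simp add: edges_def)
          show "n + card (ancestors T a) = Suc N"
            using card_ancestors_edge [OF aE] Suc.prems(2) pa by simp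
          fix u assume u: "u \<in> leaves T" "a \<in> ancestors T u"
          let ?h = "hlab T u"
          have uV: "u \<in> verts T" using u by (simp add: leaves_def)
          have vu: "v \<in> ancestors T u"
            using ancestors_trans [OF uV u(2)] pa ancestors_edge [OF aE] by auto
          note IH = Suc.prems(3) [OF u(1) vu]
          have "ylab T a \<in> ?h (xlab T (parent T a))"
            using T u aE by (auto simp: ambiguous_shattered_tree_def edges_def)
          moreover have "card (rank_edges T u \<inter> ancestors T a) \<le>
              of_bool (a \<in> rank_edges T u) + card (rank_edges T u \<inter> ancestors T v)"
            using ancestors_edge [OF aE] pa finite_ancestors [OF Suc.prems(1)]
            by (auto simp: Int_insert_right card_insert_if)
          \<comment> \<open>A rank edge outside \<open>E\<^sub>0\<close> has an unpredicted label by
            \<open>sure\<close>; for one in \<open>E\<^sub>0\<close> with all sibling labels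
            predicted, the sibling label missing from \<open>?h\<close> shows that \<open>S\<close>
            overshoots \<open>?h\<close>.\<close>
          moreover have "a \<in> rank_edges T u \<longrightarrow> mistaken ?h (xlab T v, S, ylab T a)"
            using sure pa by (auto simp: rank_edges_def)
          ultimately show "consistent ?h ((xlab T v, S, ylab T a) # rs) \<and>
              card (rank_edges T u \<inter> ancestors T a) \<le> score ?h ((xlab T v, S, ylab T a) # rs)"
            using IH pa by (auto simp: of_bool_def simp del: mistaken.simps split: if_splits)
        qed
        then show ?thesis by blast
      qed
      then show ?thesis by auto
    qed
  qed
  have "rank_edges T u \<inter> ancestors T (root T) = {}" for u
    by (auto simp: rank_edges_def)
  then show ?thesis by (intro * [OF root_in_verts]) simp_all
qed

section \<open>From strategies to trees\<close>

text \<open>Vertices will be built as lists of labels, whereas \<open>AL\<close> takes natural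
  numbers as vertices.\<close>

lemma ex_inj_list_nat: "\<exists>e :: 'y::finite list \<Rightarrow> nat. inj e"
proof -
  have "countable (lists (UNIV :: 'y set))"
    by (intro countable_lists countable_finite finite)
  then show ?thesis by (auto simp: countable_def)
qed

lemma forces_imp_tree:
  fixes H :: "('x \<Rightarrow> 'y::finite set) set"
  assumes "forces H m N []"
  shows "\<exists>T :: (nat, 'x, 'y) labelled_tree.
           ambiguous_shattered_tree H T \<and> depth T \<le> N \<and> m \<le> rank T"
proof -
  \<comment> \<open>The implication stays below the quantifiers so that the choice functions are
    total in \<open>n\<close> and \<open>rs\<close>.\<close>
  have "\<exists>x D z. forces H m (Suc n) rs \<longrightarrow> z \<in> D \<and> forces H m n ((x, D, z) # rs) \<and>
      (\<forall>y\<in>D. forces H m n ((x, {}, y) # rs))" for n rs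
  proof (cases "forces H m (Suc n) rs")
    case True
    then obtain D y x where "y \<in> D" "forces H m n ((x, D, y) # rs)"
      "\<And>z. z \<in> D \<Longrightarrow> forces H m n ((x, {}, z) # rs)"
      using forces_SucE by metis
    then show ?thesis by blast
  qed blast
  then obtain x' D' z' where choice: "\<And>n rs. forces H m (Suc n) rs \<Longrightarrow>
      z' n rs \<in> D' n rs \<and> forces H m n ((x' n rs, D' n rs, z' n rs) # rs) \<and>
      (\<forall>y\<in>D' n rs. forces H m n ((x' n rs, {}, y) # rs))"
    by metis
  \<comment> \<open>After the history \<open>rs\<close> and one more round,
    \<open>N - Suc (length rs)\<close> rounds remain.\<close>
  define x where "x rs = x' (N - Suc (length rs)) rs" for rs
  define D where "D rs = D' (N - Suc (length rs)) rs" for rs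
  define z where "z rs = z' (N - Suc (length rs)) rs" for rs
  txt \<open>A vertex is the list of labels on its path to the root; the round played along a label
    outside \<open>E\<^sub>0\<close> uses the empty prediction, which is a mistake for every hypothesis.\<close>
  define play where
    "play = (\<lambda>p. foldr (\<lambda>y rs. (x rs, if y = z rs then D rs else {}, y) # rs) p [])"
  have play_simps [simp]: "play [] = []"
    "play (y # p) = (x (play p), if y = z (play p) then D (play p) else {}, y) # play p" for y p
    by (simp_all add: play_def)
  have length_play [simp]: "length (play p) = length p" for p
    by (induction p) auto
  \<comment> \<open>The path of the parent comes after a label in the list, so each label is tested
    against the set \<open>D\<close> of the history of the remaining tail.\<close>
  define V where "V = {p. length p \<le> N \<and> (\<forall>k<length p. p ! k \<in> D (play (drop (Suc k) p)))}"
  have V_Nil [simp]: "[] \<in> V" by (simp add: V_def)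
  have V_Cons: "y # p \<in> V \<longleftrightarrow> p \<in> V \<and> length p < N \<and> y \<in> D (play p)" for y p
    by (auto simp: V_def All_less_Suc2)
  \<comment> \<open>Every vertex is a winning position: the label \<open>z\<close> answers the
    prediction \<open>D\<close>, and any other label in \<open>D\<close> wins against the empty
    prediction.\<close>
  have forces_play: "p \<in> V \<Longrightarrow> forces H m (N - length p) (play p)" for p
  proof (induction p)
    case Nil
    then show ?case using assms by simp
  next
    case (Cons y p)
    then have "p \<in> V" "length p < N" "y \<in> D (play p)" by (auto simp: V_Cons)
    then have "forces H m (Suc (N - Suc (length p))) (play p)"
      using Cons.IH by (simp add: Suc_diff_Suc)
    from choice [OF this] \<open>y \<in> D (play p)\<close> show ?case
      by (auto simp: x_def D_def z_def)
  qed
  have z_in_D: "z (play p) \<in> D (play p)" if "p \<in> V" "length p < N" for p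
  proof -
    have "forces H m (Suc (N - Suc (length p))) (play p)"
      using forces_play [OF that(1)] that(2) by (simp add: Suc_diff_Suc)
    from choice [OF this] show ?thesis by (simp add: D_def z_def)
  qed
  \<comment> \<open>Meaningful only for full paths of length \<open>N\<close>, which turn out to be
    the leaves.\<close>
  define hyp where "hyp p = (SOME h. h \<in> H \<and> consistent h (play p) \<and> m \<le> score h (play p))" for p
  have hyp: "hyp p \<in> H \<and> consistent (hyp p) (play p) \<and> m \<le> score (hyp p) (play p)"
    if "p \<in> V" "length p = N" for p
  proof -
    have "\<exists>h. h \<in> H \<and> consistent h (play p) \<and> m \<le> score h (play p)"
      using forces_play [OF that(1)] that(2) by auto
    then show ?thesis unfolding hyp_def by (rule someI_ex)
  qed
  obtain e :: "'y list \<Rightarrow> nat" where "inj e" using ex_inj_list_nat by blast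
  then have [simp]: "inv e (e p) = p" "e p = e q \<longleftrightarrow> p = q" "e p \<in> e ` A \<longleftrightarrow> p \<in> A" for p q A
    by (auto simp: inj_eq)
  define T where "T = \<lparr>verts = e ` V, root = e [], parent = (\<lambda>n. e (tl (inv e n))),
      xlab = (\<lambda>n. x (play (inv e n))), ylab = (\<lambda>n. hd (inv e n)), hlab = (\<lambda>n. hyp (inv e n)),
      edges0 = e ` {p \<in> V. p \<noteq> [] \<and> hd p = z (play (tl p))}\<rparr>"
  have T_simps [simp]: "verts T = e ` V" "root T = e []" "parent T (e p) = e (tl p)"
    "xlab T (e p) = x (play p)" "ylab T (e p) = hd p" "hlab T (e p) = hyp p"
    "edges0 T = e ` {p \<in> V. p \<noteq> [] \<and> hd p = z (play (tl p))}" for p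
    by (simp_all add: T_def)
  have edges: "edges T = e ` (V - {[]})"
    by (auto simp: edges_def)
  have tl_V: "tl p \<in> V" if "p \<in> V" for p
    using that by (cases p) (auto simp: V_Cons)
  have funpow: "(parent T ^^ k) (e p) = e (drop k p)" for k p
    by (induction k) (auto simp: drop_Suc tl_drop)
  have "finite V"
    by (rule finite_subset [OF _ finite_lists_length_le [of "UNIV :: 'y set" N]])
      (auto simp: V_def)
  then have rooted: "is_rooted_tree T"
    by (auto simp: is_rooted_tree_def edges funpow tl_V intro: exI [of _ "length _"])
  interpret rooted T by unfold_locales (rule rooted)
  have children: "children T (e p) = (\<lambda>y. e (y # p)) ` {y. y # p \<in> V}" for p
    by (auto simp: children_def edges image_iff) (metis list.collapse)
  \<comment> \<open>All leaves have depth exactly \<open>N\<close>, because a shorter path can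
    always be extended by \<open>z\<close>.\<close>
  have leaves: "leaves T = e ` {p \<in> V. length p = N}"
  proof -
    have "e p \<in> parent T ` edges T \<longleftrightarrow> length p < N" if "p \<in> V" for p
    proof
      assume "e p \<in> parent T ` edges T"
      then obtain q where "q \<in> V" "q \<noteq> []" "e p = parent T (e q)"
        unfolding edges by blast
      then show "length p < N" by (cases q) (simp_all add: V_Cons)
    next
      assume "length p < N"
      then have "z (play p) # p \<in> V" using that z_in_D by (simp add: V_Cons)
      then have "e (z (play p) # p) \<in> edges T" by (simp add: edges)
      then show "e p \<in> parent T ` edges T" by (rule rev_image_eqI) simp
    qed
    moreover have "length p \<le> N" if "p \<in> V" for p using that by (simp add: V_def)
    ultimately show ?thesis by (fastforce simp: leaves_def)
  qed
  have card_ancestors: "card (ancestors T (e p)) = Suc (length p)" if "p \<in> V" for p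
    using that
  proof (induction p)
    case Nil
    then show ?case using ancestors_root [of T] by simp
  next
    case (Cons y p)
    then show ?case using card_ancestors_edge [of "e (y # p)"] by (simp add: edges V_Cons)
  qed
  have consistent_labels: "\<forall>a\<in>ancestors T (e p) - {root T}. ylab T a \<in> h (xlab T (parent T a))"
    if "p \<in> V" "consistent h (play p)" for h p
    using that
  proof (induction p)
    case Nil
    then show ?case using ancestors_root [of T] by simp
  next
    case (Cons y p)
    then show ?case using ancestors_edge [of "e (y # p)"] by (auto simp: edges V_Cons)
  qed
  \<comment> \<open>The condition of \<open>rank_edges\<close> with a free hypothesis, which stays
    fixed while the induction on the path changes the vertex.\<close>
  define counted where "counted h a \<longleftrightarrow> a \<notin> edges0 T \<or>
      (\<exists>b\<in>children T (parent T a). ylab T b \<notin> h (xlab T (parent T a)))" for h a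
  have card_counted: "card {a \<in> ancestors T (e p) - {root T}. counted h a} = score h (play p)"
    if "p \<in> V" for h p
    using that
  proof (induction p)
    case Nil
    have "{a \<in> ancestors T (e []) - {root T}. counted h a} = {}"
      using ancestors_root [of T] by auto
    then show ?case by (simp only: card.empty) simp
  next
    case (Cons y p)
    have p: "p \<in> V" "length p < N" "y \<in> D (play p)" and edge: "e (y # p) \<in> edges T"
      using Cons.prems by (auto simp: V_Cons edges)
    \<comment> \<open>If \<open>y\<close> is the label \<open>z\<close>, the children carry exactly
      the labels in the prediction \<open>D\<close>, so both sides say that \<open>D\<close> is not
      contained in \<open>h (x (play p))\<close>; otherwise the edge is outside
      \<open>E\<^sub>0\<close> and the prediction is empty, and both sides hold.\<close>
    have "counted h (e (y # p)) \<longleftrightarrow> mistaken h (hd (play (y # p)))"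
      using p z_in_D [OF p(1,2)] Cons.prems by (auto simp: counted_def children V_Cons)
    moreover have "{a \<in> ancestors T (e (y # p)) - {root T}. counted h a} =
        (if counted h (e (y # p)) then {e (y # p)} else {}) \<union>
        {a \<in> ancestors T (e p) - {root T}. counted h a}"
      using ancestors_edge [OF edge] by auto
    moreover have "e (y # p) \<notin> ancestors T (e p)" "finite (ancestors T (e p))"
      using notin_ancestors_parent [OF edge] finite_ancestors p by auto
    ultimately show ?case using Cons.IH [OF p(1)] by auto
  qed
  have "ambiguous_shattered_tree H T"
    unfolding ambiguous_shattered_tree_def
  proof (intro conjI ballI impI)
    show "is_rooted_tree T" by (rule rooted)
    show "hlab T ` leaves T \<subseteq> H" using hyp by (auto simp: leaves)
    show "edges0 T \<subseteq> edges T" by (auto simp: edges)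
  next
    fix v assume "v \<in> inner_verts T"
    then obtain p where p: "v = e p" "p \<in> V" "length p < N"
      by (force simp: inner_verts_def leaves V_def)
    then have "children T v \<inter> edges0 T = {e (z (play p) # p)}"
      using z_in_D by (auto simp: children V_Cons)
    then show "card (children T v \<inter> edges0 T) = 1" by simp
  next
    fix a b assume "a \<in> edges T" "b \<in> edges T" "a \<noteq> b \<and> parent T a = parent T b"
    then show "ylab T a \<noteq> ylab T b" by (auto simp: edges intro: list.expand)
  next
    fix u a assume "u \<in> leaves T" "a \<in> ancestors T u - {root T}"
    then show "ylab T a \<in> hlab T u (xlab T (parent T a))"
      using consistent_labels hyp by (fastforce simp: leaves)
  qed
  moreover have "depth T \<le> N"
    by (auto simp: depth_le_iff leaves card_ancestors)
  moreover have "m \<le> rank T"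
    unfolding le_rank_iff [OF rooted]
  proof
    fix u assume "u \<in> leaves T"
    then obtain p where p: "u = e p" "p \<in> V" "length p = N" by (auto simp: leaves)
    have "card (rank_edges T u) = score (hyp p) (play p)"
      using card_counted [OF p(2), of "hyp p"] by (simp add: rank_edges_def counted_def p(1))
    then show "m \<le> card (rank_edges T u)" using hyp p by simp
  qed
  ultimately show ?thesis by blast
qed

text \<open>A tree wins with its rank as target, while a win with target \<open>m\<close> gives a
  tree of rank at least \<open>m\<close>; \<open>forces_mono\<close> closes the gap.\<close>

lemma le_AL_iff:
  fixes H :: "('x \<Rightarrow> 'y::finite set) set"
  assumes "H \<noteq> {}" and nonempty: "\<And>h. h \<in> H \<Longrightarrow> \<exists>x. h x \<noteq> {}"
  shows "m \<le> AL H N \<longleftrightarrow> forces H m N []"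
proof -
  let ?R = "{rank T | T :: (nat, 'x, 'y) labelled_tree.
               ambiguous_shattered_tree H T \<and> depth T \<le> N}"
  have R: "forces H r N []" if "r \<in> ?R" for r
    using that tree_imp_forces nonempty by blast
  have ex: "\<exists>r\<in>?R. k \<le> r" if "forces H k N []" for k
    using forces_imp_tree [OF that] by blast
  have "?R \<subseteq> {..N}" using R forces_le by fastforce
  then have fin: "finite ?R" by (rule finite_subset) simp
  obtain h x where "h \<in> H" "h x \<noteq> {}" using assms by blast
  \<comment> \<open>The idle adversary wins with target \<open>0\<close>, which yields a tree and
    makes the set of ranks non-empty.\<close>
  then have "forces H 0 N []" by (rule forces_padding) simp_all
  with ex have "?R \<noteq> {}" by blast
  with fin have "m \<le> AL H N \<longleftrightarrow> (\<exists>r\<in>?R. m \<le> r)"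
    unfolding AL_def by (rule Max_ge_iff)
  then show ?thesis using ex R forces_mono by blast
qed

theorem theorem4p1:
  fixes H :: "('x \<Rightarrow> 'y::finite set) set" and N :: nat
  assumes "H \<noteq> {}"
    and "\<And>h. h \<in> H \<Longrightarrow> \<exists>x. h x \<noteq> {}"
  shows "minimax_mistake_bound H N = AL H N"
  using le_minimax_mistake_bound_iff [OF assms] le_AL_iff [OF assms] by (metis le_antisym order_refl)

end
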